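(* Suppose there exists a tuple $\tau=(\tau_1,\ldots,\tau_\ell)$ of rational functions, with denominators strictly positive on $K$, such that $\lambda_j=\tau_j(x)$ for all $(x,\lambda)\in\mathcal{K}$ and all $j=1,\ldots,\ell$ (rational Lagrange multiplier expressions). Then the convex problems defining $f_{\mathrm{lme}}$ and $f_{\mathrm{lme},k}$ are relaxations of the problem of maximizing $\sum_{i=1}^m a_i\log p_i(x)$ over $x\in K$, and for every $k\ge\max\{d,d_1\}$ the optimal values satisfy $$f_{\mathrm{mom},k}\ \ge\ f_{\mathrm{mom}}\ \ge\ f_{\max},\qquad f_{\mathrm{lme},k}\ \ge\ f_{\mathrm{lme}}\ \ge\ f_{\max},\qquad f_{\mathrm{mom},k}\ \ge\ f_{\mathrm{lme},k},\qquad f_{\mathrm{mom}}\ \ge\ f_{\mathrm{lme}}.$$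
   Context: Let $n,m\ge 1$ be integers, $a_1,\ldots,a_m>0$ real numbers, $\mathcal{E}$ and $\mathcal{I}$ disjoint with $\mathcal{E}\cup\mathcal{I}=\{1,\ldots,\ell\}$, and $p_1,\ldots,p_m$, $c_1,\ldots,c_\ell$ real polynomials in $x=(x_1,\ldots,x_n)$. Let $$K=\{x\in\mathbb{R}^n: c_j(x)=0\ (j\in\mathcal{E}),\ c_j(x)\ge 0\ (j\in\mathcal{I})\},\qquad f(x)=\sum_{i=1}^m a_i\log p_i(x).$$ Standing assumptions: every $p_i$ is positive on $K$; the problem $f_{\max}=\max_{x\in K}f(x)$ has a maximizer; and (as holds under constraint qualifications) every maximizer is a critical point, i.e. is the $x$-part of some pair $(x,\lambda)\in\mathcal{K}$, where $$\mathcal{K}=\Big\{(x,\lambda)\in K\times\mathbb{R}^\ell:\ \nabla f(x)+\sum_{j=1}^{\ell}\lambda_j\nabla c_j(x)=0,\ \lambda_j\ge 0,\ \lambda_jc_j(x)=0\ (j\in\mathcal{I})\Big\}.$$ Convention: $\log t=-\infty$ for $t\le 0$; optimal values are suprema in the extended reals. Given $\tau$, let $D$ be a polynomial strictly positive on $K$ such that every $D\tau_j$ is a polynomial ($D=1$ if all $\tau_j$ are polynomials). Put $p^{\mathbf 1}=p_1\cdots p_m$ and $f_i=p^{\mathbf 1}/p_i$. Let $\Phi$ be the set of polynomials consisting of: $c_j$ ($j\in\mathcal{E}$); the $n$ entries of $D\sum_{i=1}^m a_if_i\nabla p_i+p^{\mathbf 1}\sum_{j=1}^{\ell}(D\tau_j)\nabla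 c_j$; and $(D\tau_j)c_j$ ($j\in\mathcal{I}$). Let $\Psi$ consist of $c_j$ and $D\tau_j$ for $j\in\mathcal{I}$. Let $$K_1=\{x\in\mathbb{R}^n:\varphi(x)=0\ (\varphi\in\Phi),\ \psi(x)\ge 0\ (\psi\in\Psi)\}.$$ Let $d$ be the maximum of $\lceil\deg(q)/2\rceil$ over $q\in\{p_1,\ldots,p_m,c_1,\ldots,c_\ell\}$ and $d_1$ the maximum of $\lceil\deg(q)/2\rceil$ over $q\in\Phi\cup\Psi$. Let $\mathbb{N}^n_k=\{\alpha\in\mathbb{N}^n:|\alpha|\le k\}$ and $[x]_k=(x^\alpha)_{\alpha\in\mathbb{N}^n_k}$. For $y\in\mathbb{R}^{\mathbb{N}^n_{2k}}$ and $q=\sum_\alpha q_\alpha x^\alpha$ of degree $\le 2k$, put $\langle q,y\rangle=\sum_\alpha q_\alpha y_\alpha$; $M_k[y]=[y_{\alpha+\beta}]_{\alpha,\beta\in\mathbb{N}^n_k}$; and, with $s=k-\lceil\deg(q)/2\rceil$, the localizing matrix $L^{(k)}_q[y]$ is obtained by applying the linear map $x^\alpha\mapsto y_\alpha$ entrywise to $q(x)[x]_s[x]_s^T$. For $S\subseteq\mathbb{R}^n$ let $\mathscr{R}_d(S)=\{\sum_{j=1}^l\lambda_j[v_j]_{2d}:\lambda_j\ge 0,\ v_j\in S,\ l\in\mathbb{N}\}$. $f_{\mathrm{mom}}$ (resp. $f_{\mathrm{lme}}$) is the optimal value of maximizing $\sum_ia_i\log\langle p_i,z\rangle$ subject to $z_0=1$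 and $z\in\mathscr{R}_d(K)$ (resp. $z\in\mathscr{R}_d(K_1)$). $f_{\mathrm{mom},k}$ is the optimal value of maximizing $\sum_ia_i\log\langle p_i,y\rangle$ over $y\in\mathbb{R}^{\mathbb{N}^n_{2k}}$ subject to $y_0=1$, $M_k[y]\succeq 0$, $L_{c_j}^{(k)}[y]=0$ ($j\in\mathcal{E}$), $L_{c_j}^{(k)}[y]\succeq 0$ ($j\in\mathcal{I}$). $f_{\mathrm{lme},k}$ is the optimal value of maximizing the same objective subject to $y_0=1$, $M_k[y]\succeq 0$, $L_\varphi^{(k)}[y]=0$ ($\varphi\in\Phi$), $L_\psi^{(k)}[y]\succeq 0$ ($\psi\in\Psi$). A maximization problem is called a relaxation of the original problem if its optimal value is at least $f_{\max}$. *)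

theory Defs
  imports
    "HOL-Analysis.Analysis"
    "HOL-Library.Poly_Mapping"
    "HOL-Computational_Algebra.Polynomial_Factorial"
begin

text \<open>A real polynomial in the variables \<open>x $ i\<close>, for \<open>i\<close> in a finite type \<open>'n\<close>, maps exponent
  vectors to coefficients, with finite support. Multiplication on this type is convolution.\<close>

type_synonym 'n expo = "'n \<Rightarrow>\<^sub>0 nat"
type_synonym 'n rpoly = "'n expo \<Rightarrow>\<^sub>0 real"

definition mono_val :: "'n::finite expo \<Rightarrow> real ^ 'n \<Rightarrow> real" where
  "mono_val \<alpha> x = (\<Prod>i\<in>UNIV. (x $ i) ^ Poly_Mapping.lookup \<alpha> i)"

definition peval :: "'n::finite rpoly \<Rightarrow> real ^ 'n \<Rightarrow> real" where
  "peval q x = (\<Sum>\<alpha>\<in>Poly_Mapping.keys q. Poly_Mapping.lookup q \<alpha> * mono_val \<alpha> x)"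

definition pconst :: "real \<Rightarrow> 'n rpoly" where
  "pconst r = Poly_Mapping.single 0 r"

definition pmonom :: "'n expo \<Rightarrow> 'n rpoly" where
  "pmonom \<alpha> = Poly_Mapping.single \<alpha> 1"

text \<open>The truncated subtraction of exponents is harmless: if the exponent of the \<open>i\<close>-th variable
  is \<open>0\<close>, then so is the coefficient.\<close>

definition partial :: "'n \<Rightarrow> 'n rpoly \<Rightarrow> 'n rpoly" where
  "partial i q = (\<Sum>\<alpha>\<in>Poly_Mapping.keys q.
     Poly_Mapping.single (\<alpha> - Poly_Mapping.single i 1) (Poly_Mapping.lookup q \<alpha> * real (Poly_Mapping.lookup \<alpha> i)))"

definition edeg :: "'n::finite expo \<Rightarrow> nat" where
  "edeg \<alpha> = (\<Sum>i\<in>UNIV. Poly_Mapping.lookup \<alpha> i)"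

text \<open>The zero polynomial gets degree \<open>0\<close>.\<close>

definition tdeg :: "'n::finite rpoly \<Rightarrow> nat" where
  "tdeg q = Max (insert 0 (edeg ` Poly_Mapping.keys q))"

definition hdeg :: "'n::finite rpoly \<Rightarrow> nat" where
  "hdeg q = nat \<lceil>real (tdeg q) / 2\<rceil>"

text \<open>Rational functions form the fraction field of the polynomial ring. (The library proves that
  this ring is an integral domain for linearly ordered \<open>'n\<close>, hence the sort constraint.) The value
  at \<open>x\<close> is computed from any representation whose denominator does not vanish at \<open>x\<close>.\<close>

definition rat_eval :: "'n rpoly fract \<Rightarrow> real ^ 'n::{finite,linorder} \<Rightarrow> real" where
  "rat_eval r x = (THE v. \<exists>N Q. r = Fraction_Field.Fract N Q \<and> peval Q x \<noteq> 0 \<and>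
                               v = peval N x / peval Q x)"

definition grad :: "('a::real_inner \<Rightarrow> real) \<Rightarrow> 'a \<Rightarrow> 'a" where
  "grad F x = (THE g. GDERIV F x :> g)"

definition semialg :: "'n::finite rpoly set \<Rightarrow> 'n rpoly set \<Rightarrow> (real ^ 'n) set" where
  "semialg Eqs Ineqs = {x. (\<forall>\<phi>\<in>Eqs. peval \<phi> x = 0) \<and> (\<forall>\<psi>\<in>Ineqs. peval \<psi> x \<ge> 0)}"

definition elog :: "real \<Rightarrow> ereal" where
  "elog t = (if t > 0 then ereal (ln t) else - \<infinity>)"

definition log_obj :: "nat \<Rightarrow> (nat \<Rightarrow> real) \<Rightarrow> (nat \<Rightarrow> real) \<Rightarrow> ereal" where
  "log_obj m a t = (\<Sum>i=1..m. ereal (a i) * elog (t i))"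

definition f_obj :: "nat \<Rightarrow> (nat \<Rightarrow> real) \<Rightarrow> (nat \<Rightarrow> 'n::finite rpoly) \<Rightarrow> real ^ 'n \<Rightarrow> ereal" where
  "f_obj m a p x = log_obj m a (\<lambda>i. peval (p i) x)"

text \<open>The set of pairs \<open>(x, lam)\<close> of critical points and multipliers. Near a point of \<open>K\<close> all \<open>p i\<close>
  are positive, so there the real-valued sum of logarithms is the objective. Vectors in
  \<open>\<real>\<^sup>l\<close> are functions on \<open>{1..l}\<close>.\<close>

definition crit_pairs ::
  "nat \<Rightarrow> (nat \<Rightarrow> real) \<Rightarrow> (nat \<Rightarrow> 'n::finite rpoly) \<Rightarrow> nat \<Rightarrow> nat set \<Rightarrow> nat set \<Rightarrow>
   (nat \<Rightarrow> 'n rpoly) \<Rightarrow> ((real ^ 'n) \<times> (nat \<Rightarrow> real)) set" where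
  "crit_pairs m a p l E I c = {(x, lam).
     x \<in> semialg (c ` E) (c ` I) \<and> lam \<in> {1..l} \<rightarrow>\<^sub>E UNIV \<and>
     grad (\<lambda>u. \<Sum>i=1..m. a i * ln (peval (p i) u)) x
       + (\<Sum>j=1..l. lam j *\<^sub>R grad (peval (c j)) x) = 0 \<and>
     (\<forall>j\<in>I. lam j \<ge> 0 \<and> lam j * peval (c j) x = 0)}"

text \<open>Here \<open>T j\<close> stands for the polynomial \<open>D \<tau>\<^sub>j\<close>, and the product over \<open>{1..m} - {k}\<close> is
  \<open>p\<^sub>1 \<cdots> p\<^sub>m / p\<^sub>k\<close>.\<close>

definition Phi ::
  "nat \<Rightarrow> (nat \<Rightarrow> real) \<Rightarrow> (nat \<Rightarrow> 'n::finite rpoly) \<Rightarrow> nat \<Rightarrow> nat set \<Rightarrow> nat set \<Rightarrow>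
   (nat \<Rightarrow> 'n rpoly) \<Rightarrow> 'n rpoly \<Rightarrow> (nat \<Rightarrow> 'n rpoly) \<Rightarrow> 'n rpoly set" where
  "Phi m a p l E I c D T =
     c ` E
     \<union> range (\<lambda>i. D * (\<Sum>k=1..m. pconst (a k) * prod p ({1..m} - {k}) * partial i (p k))
                 + prod p {1..m} * (\<Sum>j=1..l. T j * partial i (c j)))
     \<union> (\<lambda>j. T j * c j) ` I"

definition Psi :: "nat set \<Rightarrow> (nat \<Rightarrow> 'n rpoly) \<Rightarrow> (nat \<Rightarrow> 'n rpoly) \<Rightarrow> 'n rpoly set" where
  "Psi I c T = c ` I \<union> T ` I"

definition expts :: "nat \<Rightarrow> 'n::finite expo set" where
  "expts k = {\<alpha>. edeg \<alpha> \<le> k}"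

text \<open>Vectors indexed by the exponents of degree at most \<open>r\<close> are represented by functions on all
  exponents that vanish elsewhere.\<close>

definition tms :: "nat \<Rightarrow> ('n::finite expo \<Rightarrow> real) set" where
  "tms r = {y. \<forall>\<alpha>. \<alpha> \<notin> expts r \<longrightarrow> y \<alpha> = 0}"

definition mono_vec :: "nat \<Rightarrow> real ^ 'n::finite \<Rightarrow> 'n expo \<Rightarrow> real" where
  "mono_vec r x = (\<lambda>\<alpha>. if \<alpha> \<in> expts r then mono_val \<alpha> x else 0)"

definition riesz :: "'n rpoly \<Rightarrow> ('n expo \<Rightarrow> real) \<Rightarrow> real" where
  "riesz q y = (\<Sum>\<alpha>\<in>Poly_Mapping.keys q. Poly_Mapping.lookup q \<alpha> * y \<alpha>)"

definition moment_mat :: "('n expo \<Rightarrow> real) \<Rightarrow> 'n expo \<Rightarrow> 'n expo \<Rightarrow> real" where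
  "moment_mat y \<alpha> \<beta> = y (\<alpha> + \<beta>)"

definition loc_mat :: "'n rpoly \<Rightarrow> ('n expo \<Rightarrow> real) \<Rightarrow> 'n expo \<Rightarrow> 'n expo \<Rightarrow> real" where
  "loc_mat q y \<alpha> \<beta> = riesz (q * pmonom \<alpha> * pmonom \<beta>) y"

text \<open>Positive semidefiniteness of the symmetric matrix with rows and columns indexed by a finite
  set \<open>A\<close>.\<close>

definition psd_on :: "'b set \<Rightarrow> ('b \<Rightarrow> 'b \<Rightarrow> real) \<Rightarrow> bool" where
  "psd_on A M \<longleftrightarrow> (\<forall>\<alpha>\<in>A. \<forall>\<beta>\<in>A. M \<alpha> \<beta> = M \<beta> \<alpha>) \<and>
                 (\<forall>w. (\<Sum>\<alpha>\<in>A. \<Sum>\<beta>\<in>A. w \<alpha> * M \<alpha> \<beta> * w \<beta>) \<ge> 0)"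

definition moment_cone :: "nat \<Rightarrow> (real ^ 'n::finite) set \<Rightarrow> ('n expo \<Rightarrow> real) set" where
  "moment_cone d S = {z. \<exists>(r::nat) lam v. (\<forall>j\<in>{1..r}. lam j \<ge> 0 \<and> v j \<in> S) \<and>
                             z = (\<lambda>\<alpha>. \<Sum>j=1..r. lam j * mono_vec (2 * d) (v j) \<alpha>)}"

definition mom_feas :: "nat \<Rightarrow> (real ^ 'n::finite) set \<Rightarrow> ('n expo \<Rightarrow> real) set" where
  "mom_feas d S = {z. z 0 = 1 \<and> z \<in> moment_cone d S}"

definition mom_feas_k ::
  "nat \<Rightarrow> 'n::finite rpoly set \<Rightarrow> 'n rpoly set \<Rightarrow> ('n expo \<Rightarrow> real) set" where
  "mom_feas_k k Eqs Ineqs = {y \<in> tms (2 * k).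
     y 0 = 1 \<and> psd_on (expts k) (moment_mat y) \<and>
     (\<forall>\<phi>\<in>Eqs. \<forall>\<alpha>\<in>expts (k - hdeg \<phi>). \<forall>\<beta>\<in>expts (k - hdeg \<phi>). loc_mat \<phi> y \<alpha> \<beta> = 0) \<and>
     (\<forall>\<psi>\<in>Ineqs. psd_on (expts (k - hdeg \<psi>)) (loc_mat \<psi> y))}"

definition mom_obj ::
  "nat \<Rightarrow> (nat \<Rightarrow> real) \<Rightarrow> (nat \<Rightarrow> 'n rpoly) \<Rightarrow> ('n expo \<Rightarrow> real) \<Rightarrow> ereal" where
  "mom_obj m a p y = log_obj m a (\<lambda>i. riesz (p i) y)"

definition opt_val :: "('b \<Rightarrow> ereal) \<Rightarrow> 'b set \<Rightarrow> ereal" where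
  "opt_val F S = (SUP z\<in>S. F z)"

definition is_relaxation ::
  "('b \<Rightarrow> ereal) \<Rightarrow> 'b set \<Rightarrow> ('e \<Rightarrow> ereal) \<Rightarrow> 'e set \<Rightarrow> bool" where
  "is_relaxation F S G R \<longleftrightarrow> opt_val F S \<ge> opt_val G R"

text \<open>A maximization problem is convex if its feasible set is convex and its objective is concave
  there. Spelled out for a space of functions, on which the library has no vector space
  instance.\<close>

definition convex_problem :: "(('b \<Rightarrow> real) \<Rightarrow> ereal) \<Rightarrow> ('b \<Rightarrow> real) set \<Rightarrow> bool" where
  "convex_problem F S \<longleftrightarrow> (\<forall>y\<in>S. \<forall>z\<in>S. \<forall>t\<in>{0..1}.
     (\<lambda>\<alpha>. (1 - t) * y \<alpha> + t * z \<alpha>) \<in> S \<and>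
     ereal (1 - t) * F y + ereal t * F z \<le> F (\<lambda>\<alpha>. (1 - t) * y \<alpha> + t * z \<alpha>))"

end

theory Submission
  imports Defs
begin

text \<open>Maximizing over \<open>K\<close>, over truncated moment sequences of finitely atomic measures on \<open>K\<close>, and
  over solutions of semidefinite constraints are successively weaker problems. A point of \<open>K\<close> is
  its Dirac measure (\<open>f_obj_le_moment_problem\<close>). An atomic measure on \<open>K\<close> has moments of every
  order; those up to order \<open>2 * k\<close> satisfy the semidefinite constraints because a polynomial that
  is nonnegative at the atoms, multiplied by a square, has nonnegative integral
  (\<open>moment_problem_le_semidefinite_relaxation\<close>). The degree bound \<open>k \<ge> max d d1\<close> ensures that the
  truncated sequence determines all the integrals that occur. The same argument applies to \<open>K1\<close>.

  Passing from \<open>K\<close> to \<open>K1\<close> only adds constraints, so it can only decrease the optimal values. That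
  \<open>flme\<close> still bounds \<open>fmax\<close> is the point where the multiplier expressions enter: a maximizer of
  \<open>f\<close> on \<open>K\<close> is a critical point, its multipliers are the values of \<open>\<tau>\<close>, and clearing the
  denominators \<open>D\<close> and \<open>p 1 * \<dots> * p m\<close> in the optimality conditions gives the constraints that
  \<open>K1\<close> adds to \<open>K\<close> (\<open>critical_point_in_semialg_Phi_Psi\<close>). So the maximizer survives in \<open>K1\<close>. This
  needs the polynomial \<open>partial i q\<close> to represent the analytic partial derivative
  (\<open>GDERIV_peval\<close>) and evaluation of fractions to be well defined (\<open>rat_eval_Fract\<close>).

  Convexity holds because the constraints on moment sequences are linear or semidefinite, or
  describe a slice of a convex cone, while the objective is a positive combination of logarithms
  of linear functionals.\<close>

section \<open>Evaluation of polynomials\<close>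

lemma riesz_superset:
  assumes "finite A" "Poly_Mapping.keys q \<subseteq> A"
  shows "riesz q y = (\<Sum>\<alpha>\<in>A. Poly_Mapping.lookup q \<alpha> * y \<alpha>)"
  unfolding riesz_def
  by (rule sum.mono_neutral_left) (use assms in \<open>auto simp: in_keys_iff\<close>)

lemma riesz_add: "riesz (q + r) y = riesz q y + riesz r y"
proof -
  let ?A = "Poly_Mapping.keys q \<union> Poly_Mapping.keys r"
  have "riesz (q + r) y = (\<Sum>\<alpha>\<in>?A. Poly_Mapping.lookup (q + r) \<alpha> * y \<alpha>)"
    by (rule riesz_superset) (use keys_add[of q r] in auto)
  also have "\<dots> = (\<Sum>\<alpha>\<in>?A. Poly_Mapping.lookup q \<alpha> * y \<alpha>) + (\<Sum>\<alpha>\<in>?A. Poly_Mapping.lookup r \<alpha> * y \<alpha>)"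
    by (simp add: lookup_add algebra_simps sum.distrib)
  also have "\<dots> = riesz q y + riesz r y"
    by (simp add: riesz_superset[of ?A])
  finally show ?thesis .
qed

lemma riesz_zero [simp]: "riesz 0 y = 0"
  by (simp add: riesz_def)

lemma riesz_sum: "riesz (\<Sum>i\<in>A. g i) y = (\<Sum>i\<in>A. riesz (g i) y)"
  by (induction A rule: infinite_finite_induct) (simp_all add: riesz_add)

lemma riesz_single [simp]: "riesz (Poly_Mapping.single \<alpha> b) y = b * y \<alpha>"
  by (subst riesz_superset[of "{\<alpha>}"]) auto

lemma riesz_linear_right:
  "riesz q (\<lambda>\<alpha>. s * y \<alpha> + t * z \<alpha>) = s * riesz q y + t * riesz q z"
  by (simp add: riesz_def algebra_simps sum.distrib sum_distrib_left)

lemma riesz_sum_right: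
  "riesz q (\<lambda>\<alpha>. \<Sum>j\<in>J. lam j * y j \<alpha>) = (\<Sum>j\<in>J. lam j * riesz q (y j))"
  unfolding riesz_def
  by (simp add: sum_distrib_left sum.swap[of _ J]) (simp add: algebra_simps)

lemma poly_mapping_eq_sum_single:
  "q = (\<Sum>\<alpha>\<in>Poly_Mapping.keys q. Poly_Mapping.single \<alpha> (Poly_Mapping.lookup q \<alpha>))"
proof (rule poly_mapping_eqI)
  fix \<beta>
  have "(\<Sum>\<alpha>\<in>Poly_Mapping.keys q. Poly_Mapping.lookup q \<alpha> when \<alpha> = \<beta>) = Poly_Mapping.lookup q \<beta>"
    by (auto simp: when_def in_keys_iff)
  then show "Poly_Mapping.lookup q \<beta> = Poly_Mapping.lookup
     (\<Sum>\<alpha>\<in>Poly_Mapping.keys q. Poly_Mapping.single \<alpha> (Poly_Mapping.lookup q \<alpha>)) \<beta>"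
    by (simp add: lookup_sum lookup_single)
qed

text \<open>Evaluation at a point is the pairing with the full moment sequence of the Dirac measure at
  that point, so its additivity is inherited from the pairing.\<close>

lemma peval_eq_riesz: "peval q x = riesz q (\<lambda>\<alpha>. mono_val \<alpha> x)"
  by (simp add: peval_def riesz_def)

lemma mono_val_add: "mono_val (\<alpha> + \<beta>) x = mono_val \<alpha> x * mono_val \<beta> x"
  by (simp add: mono_val_def lookup_add power_add prod.distrib)

lemma mono_val_zero [simp]: "mono_val 0 x = 1"
  by (simp add: mono_val_def)

lemma peval_zero [simp]: "peval 0 x = 0"
  by (simp add: peval_eq_riesz)

lemma peval_single [simp]: "peval (Poly_Mapping.single \<alpha> b) x = b * mono_val \<alpha> x"
  by (simp add: peval_eq_riesz)

lemma peval_pconst [simp]: "peval (pconst b) x = b"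
  by (simp add: pconst_def)

lemma peval_pmonom [simp]: "peval (pmonom \<alpha>) x = mono_val \<alpha> x"
  by (simp add: pmonom_def)

lemma peval_one [simp]: "peval 1 x = 1"
  by (simp flip: single_one)

lemma peval_add [simp]: "peval (q + r) x = peval q x + peval r x"
  by (simp add: peval_eq_riesz riesz_add)

lemma peval_sum [simp]: "peval (\<Sum>i\<in>A. g i) x = (\<Sum>i\<in>A. peval (g i) x)"
  by (simp add: peval_eq_riesz riesz_sum)

lemma peval_mult [simp]: "peval (q * r) x = peval q x * peval r x"
proof -
  let ?s = "\<lambda>q. \<Sum>\<alpha>\<in>Poly_Mapping.keys q. Poly_Mapping.single \<alpha> (Poly_Mapping.lookup q \<alpha>)"
  have "q * r = ?s q * ?s r"
    using poly_mapping_eq_sum_single[of q] poly_mapping_eq_sum_single[of r] by simp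
  also have "peval \<dots> x = (\<Sum>\<alpha>\<in>Poly_Mapping.keys q. \<Sum>\<beta>\<in>Poly_Mapping.keys r.
      (Poly_Mapping.lookup q \<alpha> * mono_val \<alpha> x) * (Poly_Mapping.lookup r \<beta> * mono_val \<beta> x))"
    by (simp add: sum_product mult_single mono_val_add algebra_simps)
  also have "\<dots> = peval q x * peval r x"
    by (simp add: peval_def sum_product)
  finally show ?thesis .
qed

lemma peval_prod [simp]: "peval (\<Prod>i\<in>A. g i) x = (\<Prod>i\<in>A. peval (g i) x)"
  by (induction A rule: infinite_finite_induct) simp_all

text \<open>Two representations \<open>N / Q\<close> and \<open>N' / Q'\<close> of the same fraction satisfy \<open>N * Q' = N' * Q\<close>
  as polynomials, hence as functions, so the value does not depend on the representation.\<close>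

lemma rat_eval_Fract:
  assumes "peval Q x \<noteq> 0"
  shows "rat_eval (Fraction_Field.Fract N Q) x = peval N x / peval Q x"
  unfolding rat_eval_def
proof (rule the_equality)
  show "\<exists>N' Q'. Fraction_Field.Fract N Q = Fraction_Field.Fract N' Q' \<and> peval Q' x \<noteq> 0 \<and>
          peval N x / peval Q x = peval N' x / peval Q' x"
    using assms by blast
next
  fix v
  assume "\<exists>N' Q'. Fraction_Field.Fract N Q = Fraction_Field.Fract N' Q' \<and> peval Q' x \<noteq> 0 \<and>
            v = peval N' x / peval Q' x"
  then obtain N' Q' where eq: "Fraction_Field.Fract N Q = Fraction_Field.Fract N' Q'"
    and Q': "peval Q' x \<noteq> 0" and v: "v = peval N' x / peval Q' x"
    by blast
  have "Q \<noteq> 0" "Q' \<noteq> 0"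
    using assms Q' by auto
  then have "N * Q' = N' * Q"
    using eq by (simp add: eq_fract)
  then have "peval N x * peval Q' x = peval N' x * peval Q x"
    by (metis peval_mult)
  then show "v = peval N x / peval Q x"
    unfolding v using assms Q' by (simp add: frac_eq_eq)
qed

lemma rat_eval_cleared:
  assumes "to_fract D * r = to_fract T" "r = Fraction_Field.Fract N Q" "peval Q x \<noteq> 0"
  shows "peval T x = peval D x * rat_eval r x"
proof -
  have "Q \<noteq> 0"
    using assms(3) by auto
  moreover have "Fraction_Field.Fract (D * N) Q = Fraction_Field.Fract T 1"
    using assms(1,2) by (simp add: to_fract_def)
  ultimately have "D * N = T * Q"
    by (simp add: eq_fract)
  then have "peval D x * peval N x = peval T x * peval Q x"
    by (metis peval_mult)
  then show ?thesis
    using assms by (simp add: rat_eval_Fract field_simps)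
qed

section \<open>Gradients of polynomials\<close>

lemma mono_val_minus_single:
  assumes "Poly_Mapping.lookup \<alpha> i > 0"
  shows "mono_val (\<alpha> - Poly_Mapping.single i 1) x =
    (x $ i) ^ (Poly_Mapping.lookup \<alpha> i - 1) * (\<Prod>j\<in>UNIV - {i}. (x $ j) ^ Poly_Mapping.lookup \<alpha> j)"
proof -
  have "mono_val (\<alpha> - Poly_Mapping.single i 1) x =
      (\<Prod>j\<in>UNIV. (x $ j) ^ (Poly_Mapping.lookup \<alpha> j - (1 when i = j)))"
    by (simp add: mono_val_def lookup_minus lookup_single)
  also have "\<dots> = (x $ i) ^ (Poly_Mapping.lookup \<alpha> i - 1) *
      (\<Prod>j\<in>UNIV - {i}. (x $ j) ^ (Poly_Mapping.lookup \<alpha> j - (1 when i = j)))"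
    by (subst prod.remove[of UNIV i]) auto
  also have "(\<Prod>j\<in>UNIV - {i}. (x $ j) ^ (Poly_Mapping.lookup \<alpha> j - (1 when i = j))) =
      (\<Prod>j\<in>UNIV - {i}. (x $ j) ^ Poly_Mapping.lookup \<alpha> j)"
    by (rule prod.cong) (auto simp: when_def)
  finally show ?thesis .
qed

lemma has_derivative_mono_val:
  "(mono_val \<alpha> has_derivative
     (\<lambda>h. \<Sum>i\<in>UNIV. h $ i * (real (Poly_Mapping.lookup \<alpha> i) * mono_val (\<alpha> - Poly_Mapping.single i 1) x)))
   (at x)"
proof -
  let ?n = "Poly_Mapping.lookup \<alpha>"
  have "((\<lambda>x. \<Prod>i\<in>UNIV. (x $ i) ^ ?n i) has_derivative
     (\<lambda>h. \<Sum>i\<in>UNIV. (real (?n i) * h $ i * (x $ i) ^ (?n i - 1)) * (\<Prod>j\<in>UNIV - {i}. (x $ j) ^ ?n j))) (at x)"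
    by (rule has_derivative_prod)
       (rule has_derivative_power[OF bounded_linear.has_derivative[OF bounded_linear_vec_nth
          has_derivative_ident]])
  moreover have "(real (?n i) * h $ i * (x $ i) ^ (?n i - 1)) * (\<Prod>j\<in>UNIV - {i}. (x $ j) ^ ?n j) =
     h $ i * (real (?n i) * mono_val (\<alpha> - Poly_Mapping.single i 1) x)" for i and h :: "real ^ 'a"
    by (cases "?n i = 0") (simp_all only: mono_val_minus_single, simp_all)
  moreover have "mono_val \<alpha> = (\<lambda>x. \<Prod>i\<in>UNIV. (x $ i) ^ ?n i)"
    by (simp add: fun_eq_iff mono_val_def)
  ultimately show ?thesis
    by (simp only:)
qed

lemma GDERIV_peval: "GDERIV (peval q) x :> (\<chi> i. peval (partial i q) x)"
proof -
  let ?c = "Poly_Mapping.lookup q"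
  have "((\<lambda>x. \<Sum>\<alpha>\<in>Poly_Mapping.keys q. ?c \<alpha> * mono_val \<alpha> x) has_derivative
     (\<lambda>h. \<Sum>\<alpha>\<in>Poly_Mapping.keys q. ?c \<alpha> * (\<Sum>i\<in>UNIV. h $ i *
        (real (Poly_Mapping.lookup \<alpha> i) * mono_val (\<alpha> - Poly_Mapping.single i 1) x)))) (at x)"
    by (intro has_derivative_sum has_derivative_mult_right has_derivative_mono_val)
  moreover have "(\<Sum>\<alpha>\<in>Poly_Mapping.keys q. ?c \<alpha> * (\<Sum>i\<in>UNIV. h $ i *
        (real (Poly_Mapping.lookup \<alpha> i) * mono_val (\<alpha> - Poly_Mapping.single i 1) x))) =
      h \<bullet> (\<chi> i. peval (partial i q) x)" for h
    by (simp add: inner_vec_def partial_def sum_distrib_left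
          sum.swap[of _ "Poly_Mapping.keys q"] mult_ac)
  ultimately show ?thesis
    unfolding gderiv_def by (simp add: peval_def[abs_def])
qed

lemma grad_eqI:
  assumes "GDERIV F x :> g"
  shows "grad F x = g"
  unfolding grad_def
proof (rule the_equality[where P = "\<lambda>g. GDERIV F x :> g", OF assms])
  fix g' assume "GDERIV F x :> g'"
  then have "(\<lambda>h. h \<bullet> g') = (\<lambda>h. h \<bullet> g)"
    using assms unfolding gderiv_def by (rule has_derivative_unique)
  then have "\<forall>h. h \<bullet> g' = h \<bullet> g"
    by (simp add: fun_eq_iff)
  then show "g' = g"
    by (simp only: vector_eq_ldot)
qed

lemma grad_peval: "grad (peval q) x = (\<chi> i. peval (partial i q) x)"
  by (rule grad_eqI[OF GDERIV_peval])

lemma grad_sum_ln_peval: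
  assumes "\<forall>k\<in>A. peval (p k) x > 0"
  shows "grad (\<lambda>u. \<Sum>k\<in>A. a k * ln (peval (p k) u)) x =
    (\<chi> i. \<Sum>k\<in>A. a k * peval (partial i (p k)) x / peval (p k) x)"
proof (rule grad_eqI)
  have "((\<lambda>u. \<Sum>k\<in>A. a k * ln (peval (p k) u)) has_derivative
     (\<lambda>h. \<Sum>k\<in>A. a k * (h \<bullet> (inverse (peval (p k) x) *\<^sub>R (\<chi> i. peval (partial i (p k)) x))))) (at x)"
  proof (intro has_derivative_sum has_derivative_mult_right)
    fix k assume "k \<in> A"
    then have "DERIV ln (peval (p k) x) :> inverse (peval (p k) x)"
      using assms by (intro DERIV_ln) auto
    from GDERIV_DERIV_compose[OF GDERIV_peval this]
    show "((\<lambda>u. ln (peval (p k) u)) has_derivative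
       (\<lambda>h. h \<bullet> (inverse (peval (p k) x) *\<^sub>R (\<chi> i. peval (partial i (p k)) x)))) (at x)"
      by (simp add: gderiv_def)
  qed
  moreover have "(\<Sum>k\<in>A. a k * (h \<bullet> (inverse (peval (p k) x) *\<^sub>R (\<chi> i. peval (partial i (p k)) x)))) =
      h \<bullet> (\<chi> i. \<Sum>k\<in>A. a k * peval (partial i (p k)) x / peval (p k) x)" for h
    by (simp add: inner_vec_def sum_distrib_left sum.swap[of _ A] field_simps)
  ultimately show "GDERIV (\<lambda>u. \<Sum>k\<in>A. a k * ln (peval (p k) u)) x :>
      (\<chi> i. \<Sum>k\<in>A. a k * peval (partial i (p k)) x / peval (p k) x)"
    unfolding gderiv_def by simp
qed

section \<open>Degrees\<close>

lemma edeg_add: "edeg (\<alpha> + \<beta>) = edeg \<alpha> + edeg \<beta>"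
  by (simp add: edeg_def lookup_add sum.distrib)

lemma zero_in_expts [simp]: "0 \<in> expts k"
  by (simp add: expts_def edeg_def)

lemma edeg_le_tdeg: "\<alpha> \<in> Poly_Mapping.keys q \<Longrightarrow> edeg \<alpha> \<le> tdeg q"
  by (simp add: tdeg_def)

lemma tdeg_le_hdeg: "tdeg q \<le> 2 * hdeg q"
  unfolding hdeg_def by linarith

lemma hdeg_one [simp]: "hdeg 1 = 0"
  by (simp add: hdeg_def tdeg_def edeg_def flip: single_one)

lemma edeg_keys_localized:
  assumes "hdeg q \<le> k" "\<alpha> \<in> expts (k - hdeg q)" "\<beta> \<in> expts (k - hdeg q)"
    and "\<gamma> \<in> Poly_Mapping.keys (q * pmonom \<alpha> * pmonom \<beta>)"
  shows "edeg \<gamma> \<le> 2 * k"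
proof -
  have keys: "Poly_Mapping.keys (pmonom \<delta>) = {\<delta>}" for \<delta> :: "'a expo"
    by (simp add: pmonom_def)
  obtain \<delta>' where "\<delta>' \<in> Poly_Mapping.keys (q * pmonom \<alpha>)" "\<gamma> = \<delta>' + \<beta>"
    using assms(4) keys_mult[of "q * pmonom \<alpha>" "pmonom \<beta>"] unfolding keys by blast
  moreover from this(1) obtain \<delta> where \<delta>: "\<delta> \<in> Poly_Mapping.keys q" and "\<delta>' = \<delta> + \<alpha>"
    using keys_mult[of q "pmonom \<alpha>"] unfolding keys by blast
  ultimately have \<gamma>: "\<gamma> = \<delta> + \<alpha> + \<beta>"
    by simp
  have "edeg \<gamma> \<le> 2 * hdeg q + (k - hdeg q) + (k - hdeg q)"
    using assms(2,3) edeg_le_tdeg[OF \<delta>] tdeg_le_hdeg[of q]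
    by (simp add: \<gamma> edeg_add expts_def)
  then show ?thesis
    using assms(1) by linarith
qed

section \<open>Concavity of the objective\<close>

lemma elog_concave:
  assumes "0 < t" "t < 1"
  shows "ereal (1 - t) * elog u + ereal t * elog v \<le> elog ((1 - t) * u + t * v)"
proof (cases "u > 0 \<and> v > 0")
  case True
  have "(1 - t) * ln u + t * ln v \<le> ln ((1 - t) * u + t * v)"
    using concave_onD[OF ln_concave, of t u v] assms True by simp
  moreover have "(1 - t) * u + t * v > 0"
    using True assms by (simp add: add_pos_pos)
  ultimately show ?thesis
    using True by (simp add: elog_def)
next
  case False
  then show ?thesis
    using assms by (auto simp: elog_def)
qed

lemma ereal_times_sum:
  fixes g :: "nat \<Rightarrow> ereal"
  assumes "s > 0" "finite A" "\<forall>i\<in>A. g i \<noteq> \<infinity>"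
  shows "ereal s * sum g A = (\<Sum>i\<in>A. ereal s * g i)"
  using assms(2,3)
proof (induction A rule: finite_induct)
  case (insert x A)
  have "sum g A \<noteq> \<infinity>"
    using insert by (auto simp: sum_Pinfty)
  moreover have "g x \<noteq> \<infinity>"
    using insert by auto
  ultimately have "ereal s * (g x + sum g A) = ereal s * g x + ereal s * sum g A"
    using assms(1) by (cases "g x"; cases "sum g A") (simp_all add: distrib_left)
  then show ?case
    using insert by simp
qed simp

text \<open>At \<open>t = 0\<close> and \<open>t = 1\<close> the convention \<open>0 * (-\<infinity>) = 0\<close> makes both sides equal; in between,
  the inequality is the concavity of the logarithm with the value \<open>-\<infinity>\<close> outside its domain.\<close>

lemma log_obj_concave:
  assumes a: "\<forall>i\<in>{1..m}. a i > 0" and t: "t \<in> {0..1}"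
  shows "ereal (1 - t) * log_obj m a u + ereal t * log_obj m a v
       \<le> log_obj m a (\<lambda>i. (1 - t) * u i + t * v i)"
proof -
  consider "t = 0" | "t = 1" | "0 < t" "t < 1"
    using t by force
  then show ?thesis
  proof cases
    case 3
    have term_fin: "ereal (a i) * elog (w i) \<noteq> \<infinity>" if "i \<in> {1..m}" for i and w :: "nat \<Rightarrow> real"
    proof -
      have "a i > 0"
        using a that by blast
      then show ?thesis
        by (simp add: elog_def)
    qed
    have "ereal (1 - t) * log_obj m a u + ereal t * log_obj m a v =
        (\<Sum>i=1..m. ereal (1 - t) * (ereal (a i) * elog (u i)) + ereal t * (ereal (a i) * elog (v i)))"
      unfolding log_obj_def sum.distrib using 3 term_fin by (subst (1 2) ereal_times_sum) auto
    also have "\<dots> \<le> (\<Sum>i=1..m. ereal (a i) * elog ((1 - t) * u i + t * v i))"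
    proof (rule sum_mono)
      fix i assume i: "i \<in> {1..m}"
      then have ai: "a i > 0" using a by blast
      have "ereal (1 - t) * (ereal (a i) * elog (u i)) + ereal t * (ereal (a i) * elog (v i)) =
          ereal (a i) * (ereal (1 - t) * elog (u i) + ereal t * elog (v i))"
        using ai 3 by (auto simp: elog_def algebra_simps)
      also have "\<dots> \<le> ereal (a i) * elog ((1 - t) * u i + t * v i)"
        using ai by (intro ereal_mult_left_mono elog_concave 3) auto
      finally show "ereal (1 - t) * (ereal (a i) * elog (u i)) + ereal t * (ereal (a i) * elog (v i))
          \<le> ereal (a i) * elog ((1 - t) * u i + t * v i)" .
    qed
    finally show ?thesis
      by (simp add: log_obj_def)
  qed (simp_all flip: zero_ereal_def one_ereal_def)
qed

lemma convex_problem_mom_obj: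
  assumes "\<forall>i\<in>{1..m}. a i > 0"
    and "\<And>y z t. y \<in> S \<Longrightarrow> z \<in> S \<Longrightarrow> t \<in> {0..1} \<Longrightarrow> (\<lambda>\<alpha>. (1 - t) * y \<alpha> + t * z \<alpha>) \<in> S"
  shows "convex_problem (mom_obj m a p) S"
  unfolding convex_problem_def mom_obj_def riesz_linear_right
  using assms log_obj_concave[OF assms(1)] by blast

section \<open>Convexity of the feasible sets\<close>

lemma moment_cone_add:
  assumes "y \<in> moment_cone d S" "z \<in> moment_cone d S" "s \<ge> 0" "t \<ge> 0"
  shows "(\<lambda>\<alpha>. s * y \<alpha> + t * z \<alpha>) \<in> moment_cone d S"
proof -
  obtain r lam v where y: "\<forall>j\<in>{1..r}. lam j \<ge> 0 \<and> v j \<in> S"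
      "y = (\<lambda>\<alpha>. \<Sum>j=1..(r::nat). lam j * mono_vec (2 * d) (v j) \<alpha>)"
    using assms(1) unfolding moment_cone_def by blast
  obtain r' lam' v' where z: "\<forall>j\<in>{1..r'}. lam' j \<ge> 0 \<and> v' j \<in> S"
      "z = (\<lambda>\<alpha>. \<Sum>j=1..(r'::nat). lam' j * mono_vec (2 * d) (v' j) \<alpha>)"
    using assms(2) unfolding moment_cone_def by blast
  \<comment> \<open>The two lists of atoms are concatenated, with rescaled weights.\<close>
  define lam'' where "lam'' j = (if j \<le> r then s * lam j else t * lam' (j - r))" for j
  define v'' where "v'' j = (if j \<le> r then v j else v' (j - r))" for j
  have nonneg: "\<forall>j\<in>{1..r + r'}. lam'' j \<ge> 0 \<and> v'' j \<in> S"
  proof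
    fix j assume "j \<in> {1..r + r'}"
    then have "j \<in> {1..r} \<or> (\<not> j \<le> r \<and> j - r \<in> {1..r'})"
      by auto
    then show "lam'' j \<ge> 0 \<and> v'' j \<in> S"
      using y(1) z(1) assms(3,4) by (auto simp: lam''_def v''_def)
  qed
  have eq: "s * y \<alpha> + t * z \<alpha> = (\<Sum>j=1..r + r'. lam'' j * mono_vec (2 * d) (v'' j) \<alpha>)" for \<alpha>
  proof -
    let ?g = "\<lambda>j. lam'' j * mono_vec (2 * d) (v'' j) \<alpha>"
    have "(\<Sum>j=1..r + r'. ?g j) = (\<Sum>j=1..r. ?g j) + (\<Sum>j=r + 1..r + r'. ?g j)"
      by (rule sum.ub_add_nat) simp
    also have "(\<Sum>j=1..r. ?g j) = s * y \<alpha>"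
      by (simp add: y(2) lam''_def v''_def sum_distrib_left mult.assoc)
    also have "(\<Sum>j=r + 1..r + r'. ?g j) = (\<Sum>j=1..r'. ?g (j + r))"
      using sum.shift_bounds_cl_nat_ivl[of ?g 1 r r'] by (simp add: add.commute)
    also have "\<dots> = t * z \<alpha>"
      unfolding z(2) sum_distrib_left by (rule sum.cong) (auto simp: lam''_def v''_def)
    finally show ?thesis
      by simp
  qed
  show ?thesis
    unfolding moment_cone_def using nonneg eq by blast
qed

lemma convex_problem_mom_feas:
  assumes "\<forall>i\<in>{1..m}. a i > 0"
  shows "convex_problem (mom_obj m a p) (mom_feas d S)"
  by (rule convex_problem_mom_obj[OF assms]) (auto simp: mom_feas_def moment_cone_add)

lemma psd_on_convex:
  assumes "psd_on A M" "psd_on A N" "s \<ge> 0" "t \<ge> 0"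
  shows "psd_on A (\<lambda>\<alpha> \<beta>. s * M \<alpha> \<beta> + t * N \<alpha> \<beta>)"
  unfolding psd_on_def
proof (intro conjI allI ballI)
  fix \<alpha> \<beta> assume "\<alpha> \<in> A" "\<beta> \<in> A"
  then have "M \<alpha> \<beta> = M \<beta> \<alpha>" "N \<alpha> \<beta> = N \<beta> \<alpha>"
    using assms(1,2) unfolding psd_on_def by blast+
  then show "s * M \<alpha> \<beta> + t * N \<alpha> \<beta> = s * M \<beta> \<alpha> + t * N \<beta> \<alpha>"
    by simp
next
  fix w
  have "(\<Sum>\<alpha>\<in>A. \<Sum>\<beta>\<in>A. w \<alpha> * (s * M \<alpha> \<beta> + t * N \<alpha> \<beta>) * w \<beta>) =
      s * (\<Sum>\<alpha>\<in>A. \<Sum>\<beta>\<in>A. w \<alpha> * M \<alpha> \<beta> * w \<beta>) + t * (\<Sum>\<alpha>\<in>A. \<Sum>\<beta>\<in>A. w \<alpha> * N \<alpha> \<beta> * w \<beta>)"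
    by (simp add: sum_distrib_left sum.distrib algebra_simps)
  moreover have "\<dots> \<ge> 0"
    using assms unfolding psd_on_def by (intro add_nonneg_nonneg mult_nonneg_nonneg) auto
  ultimately show "(\<Sum>\<alpha>\<in>A. \<Sum>\<beta>\<in>A. w \<alpha> * (s * M \<alpha> \<beta> + t * N \<alpha> \<beta>) * w \<beta>) \<ge> 0"
    by simp
qed

text \<open>The moment matrix is the localizing matrix of the constant \<open>1\<close>, so every statement about
  localizing matrices covers both.\<close>

lemma moment_mat_eq_loc_mat: "moment_mat y = loc_mat 1 y"
  by (simp add: fun_eq_iff moment_mat_def loc_mat_def pmonom_def mult_single)

lemma loc_mat_linear:
  "loc_mat q (\<lambda>\<alpha>. s * y \<alpha> + t * z \<alpha>) = (\<lambda>\<alpha> \<beta>. s * loc_mat q y \<alpha> \<beta> + t * loc_mat q z \<alpha> \<beta>)"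
  by (simp add: fun_eq_iff loc_mat_def riesz_linear_right)

lemma convex_problem_mom_feas_k:
  assumes "\<forall>i\<in>{1..m}. a i > 0"
  shows "convex_problem (mom_obj m a p) (mom_feas_k k Eqs Ineqs)"
  by (rule convex_problem_mom_obj[OF assms])
     (auto simp: mom_feas_k_def tms_def moment_mat_eq_loc_mat loc_mat_linear psd_on_convex)

section \<open>Moments of finitely atomic measures\<close>

text \<open>A truncated moment sequence of a finitely atomic measure integrates every polynomial whose
  degree does not exceed the order of truncation.\<close>

lemma riesz_atomic:
  assumes "\<And>\<alpha>. \<alpha> \<in> Poly_Mapping.keys q \<Longrightarrow> edeg \<alpha> \<le> r"
  shows "riesz q (\<lambda>\<alpha>. \<Sum>j\<in>J. lam j * mono_vec r (v j) \<alpha>) = (\<Sum>j\<in>J. lam j * peval q (v j))"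
proof -
  have "riesz q (mono_vec r x) = peval q x" for x
    unfolding riesz_def peval_def
    by (rule sum.cong) (use assms in \<open>auto simp: mono_vec_def expts_def\<close>)
  then show ?thesis
    by (simp add: riesz_sum_right)
qed

lemma loc_mat_atomic:
  assumes "hdeg q \<le> k" "\<alpha> \<in> expts (k - hdeg q)" "\<beta> \<in> expts (k - hdeg q)"
  shows "loc_mat q (\<lambda>\<alpha>. \<Sum>j\<in>J. lam j * mono_vec (2 * k) (v j) \<alpha>) \<alpha> \<beta> =
    (\<Sum>j\<in>J. lam j * (peval q (v j) * mono_val \<alpha> (v j) * mono_val \<beta> (v j)))"
  unfolding loc_mat_def
  by (subst riesz_atomic) (use edeg_keys_localized[OF assms] in auto)

text \<open>If \<open>q\<close> is nonnegative at the atoms, the quadratic form of the localizing matrix is a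
  nonnegative combination of squares: at the vector \<open>w\<close> it integrates \<open>q\<close> times the square of the
  polynomial with coefficients \<open>w\<close>.\<close>

lemma psd_loc_mat_atomic:
  assumes "hdeg q \<le> k" "\<And>j. j \<in> J \<Longrightarrow> lam j \<ge> 0 \<and> peval q (v j) \<ge> 0"
  shows "psd_on (expts (k - hdeg q)) (loc_mat q (\<lambda>\<alpha>. \<Sum>j\<in>J. lam j * mono_vec (2 * k) (v j) \<alpha>))"
    (is "psd_on ?A (loc_mat q ?y)")
  unfolding psd_on_def
proof (intro conjI allI ballI)
  fix \<alpha> \<beta>
  show "loc_mat q ?y \<alpha> \<beta> = loc_mat q ?y \<beta> \<alpha>"
    by (simp add: loc_mat_def mult_ac)
next
  fix w
  have "(\<Sum>\<alpha>\<in>?A. \<Sum>\<beta>\<in>?A. w \<alpha> * loc_mat q ?y \<alpha> \<beta> * w \<beta>) =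
      (\<Sum>\<alpha>\<in>?A. \<Sum>\<beta>\<in>?A. \<Sum>j\<in>J. lam j * peval q (v j) * ((w \<alpha> * mono_val \<alpha> (v j)) * (w \<beta> * mono_val \<beta> (v j))))"
    by (intro sum.cong refl)
       (simp only: loc_mat_atomic[OF assms(1)], simp add: sum_distrib_left sum_distrib_right mult_ac)
  also have "\<dots> = (\<Sum>j\<in>J. \<Sum>\<alpha>\<in>?A. \<Sum>\<beta>\<in>?A. lam j * peval q (v j) * ((w \<alpha> * mono_val \<alpha> (v j)) * (w \<beta> * mono_val \<beta> (v j))))"
    by (simp only: sum.swap[of _ J])
  also have "\<dots> = (\<Sum>j\<in>J. lam j * peval q (v j) * (\<Sum>\<alpha>\<in>?A. w \<alpha> * mono_val \<alpha> (v j))\<^sup>2)"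
    by (simp only: power2_eq_square sum_product, simp only: sum_distrib_left)
  also have "\<dots> \<ge> 0"
    using assms(2) by (intro sum_nonneg mult_nonneg_nonneg) auto
  finally show "(\<Sum>\<alpha>\<in>?A. \<Sum>\<beta>\<in>?A. w \<alpha> * loc_mat q ?y \<alpha> \<beta> * w \<beta>) \<ge> 0" .
qed

section \<open>The relaxation inequalities\<close>

lemma opt_val_mono_map:
  assumes "\<And>z. z \<in> S \<Longrightarrow> \<exists>y\<in>R. F z \<le> G y"
  shows "opt_val F S \<le> opt_val G R"
  unfolding opt_val_def using assms by (rule SUP_mono)

lemma mom_feas_mono: "S \<subseteq> R \<Longrightarrow> mom_feas d S \<subseteq> mom_feas d R"
  unfolding mom_feas_def moment_cone_def by blast

text \<open>A point is represented by its Dirac measure.\<close>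

lemma f_obj_le_moment_problem:
  assumes "\<And>i. i \<in> {1..m} \<Longrightarrow> hdeg (p i) \<le> d" and "x \<in> S"
  shows "f_obj m a p x \<le> opt_val (mom_obj m a p) (mom_feas d S)"
proof -
  define z where "z = (\<lambda>\<alpha>. \<Sum>j=1..(1::nat). 1 * mono_vec (2 * d) x \<alpha>)"
  have "z \<in> mom_feas d S"
    unfolding mom_feas_def moment_cone_def z_def using assms(2)
    by (auto simp: mono_vec_def intro!: exI[of _ "1::nat"] exI[of _ "\<lambda>_. 1"] exI[of _ "\<lambda>_. x"])
  moreover have "riesz (p i) z = peval (p i) x" if "i \<in> {1..m}" for i
    unfolding z_def
    by (subst riesz_atomic)
       (use edeg_le_tdeg[of _ "p i"] tdeg_le_hdeg[of "p i"] assms(1)[OF that] in \<open>force+\<close>)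
  then have "mom_obj m a p z = f_obj m a p x"
    by (simp add: mom_obj_def f_obj_def log_obj_def)
  ultimately show ?thesis
    unfolding opt_val_def by (metis SUP_upper)
qed

text \<open>Raising the order of truncation of a representing atomic measure from \<open>2 * d\<close> to \<open>2 * k\<close>
  leaves the objective unchanged, and the longer moment sequence satisfies the semidefinite
  constraints because its atoms satisfy the polynomial ones.\<close>

lemma moment_problem_le_semidefinite_relaxation:
  assumes p: "\<And>i. i \<in> {1..m} \<Longrightarrow> hdeg (p i) \<le> d" and "d \<le> k"
    and q: "\<And>q. q \<in> Eqs \<union> Ineqs \<Longrightarrow> hdeg q \<le> k"
  shows "opt_val (mom_obj m a p) (mom_feas d (semialg Eqs Ineqs))
       \<le> opt_val (mom_obj m a p) (mom_feas_k k Eqs Ineqs)"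
proof (rule opt_val_mono_map)
  fix z assume z: "z \<in> mom_feas d (semialg Eqs Ineqs)"
  then obtain r lam v where lv: "\<And>j. j \<in> {1..r} \<Longrightarrow> lam j \<ge> 0 \<and> v j \<in> semialg Eqs Ineqs"
      and z_eq: "z = (\<lambda>\<alpha>. \<Sum>j=1..(r::nat). lam j * mono_vec (2 * d) (v j) \<alpha>)"
    unfolding mom_feas_def moment_cone_def by blast
  define y where "y = (\<lambda>\<alpha>. \<Sum>j=1..r. lam j * mono_vec (2 * k) (v j) \<alpha>)"
  have "y \<in> tms (2 * k)"
    by (simp add: tms_def y_def mono_vec_def)
  moreover have "y 0 = 1"
    using z by (simp add: mom_feas_def y_def z_eq mono_vec_def)
  moreover have "psd_on (expts k) (moment_mat y)"
    using psd_loc_mat_atomic[of 1 k "{1..r}" lam v] lv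
    by (simp add: moment_mat_eq_loc_mat y_def)
  moreover have "loc_mat \<phi> y \<alpha> \<beta> = 0"
    if "\<phi> \<in> Eqs" "\<alpha> \<in> expts (k - hdeg \<phi>)" "\<beta> \<in> expts (k - hdeg \<phi>)" for \<phi> \<alpha> \<beta>
    unfolding y_def using that lv q
    by (subst loc_mat_atomic) (auto simp: semialg_def intro!: sum.neutral)
  moreover have "psd_on (expts (k - hdeg \<psi>)) (loc_mat \<psi> y)" if "\<psi> \<in> Ineqs" for \<psi>
    unfolding y_def using that lv q by (intro psd_loc_mat_atomic) (auto simp: semialg_def)
  ultimately have "y \<in> mom_feas_k k Eqs Ineqs"
    by (simp add: mom_feas_k_def)
  moreover have "riesz (p i) z = riesz (p i) y" if "i \<in> {1..m}" for i
  proof -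
    have le: "edeg \<alpha> \<le> 2 * d" if "\<alpha> \<in> Poly_Mapping.keys (p i)" for \<alpha>
      using edeg_le_tdeg[OF that] tdeg_le_hdeg[of "p i"] p[OF \<open>i \<in> {1..m}\<close>] by linarith
    then have "edeg \<alpha> \<le> 2 * k" if "\<alpha> \<in> Poly_Mapping.keys (p i)" for \<alpha>
      using that \<open>d \<le> k\<close> by fastforce
    with le show ?thesis
      by (simp add: y_def z_eq riesz_atomic)
  qed
  then have "mom_obj m a p z \<le> mom_obj m a p y"
    by (simp add: mom_obj_def log_obj_def)
  ultimately show "\<exists>y\<in>mom_feas_k k Eqs Ineqs. mom_obj m a p z \<le> mom_obj m a p y"
    by blast
qed

section \<open>Lagrange multiplier expressions\<close>

text \<open>Write \<open>P\<close> for the product of all \<open>p k\<close>. At a critical point with multipliers \<open>lam\<close> and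
  \<open>T j = D * lam j\<close>, the polynomials of \<open>Phi\<close> that express stationarity take the value of
  \<open>D * P\<close> times the gradient of the Lagrangian; the other constraints are feasibility of \<open>x\<close> and
  the sign and complementarity conditions on \<open>lam\<close>, scaled by the value of \<open>D\<close>.\<close>

lemma critical_point_in_semialg_Phi_Psi:
  assumes crit: "(x, lam) \<in> crit_pairs m a p l E I c" and EI: "E \<union> I = {1..l}"
    and p: "\<forall>k\<in>{1..m}. peval (p k) x > 0"
    and D: "peval D x \<ge> 0" and T: "\<And>j. j \<in> {1..l} \<Longrightarrow> peval (T j) x = peval D x * lam j"
  shows "x \<in> semialg (Phi m a p l E I c D T) (Psi I c T)"
proof -
  have x: "x \<in> semialg (c ` E) (c ` I)"
    and stat: "grad (\<lambda>u. \<Sum>k=1..m. a k * ln (peval (p k) u)) x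
                + (\<Sum>j=1..l. lam j *\<^sub>R grad (peval (c j)) x) = 0"
    and compl: "\<forall>j\<in>I. lam j \<ge> 0 \<and> lam j * peval (c j) x = 0"
    using crit unfolding crit_pairs_def by auto
  define P where "P = (\<Prod>k=1..m. peval (p k) x)"
  have stationary: "peval (D * (\<Sum>k=1..m. pconst (a k) * prod p ({1..m} - {k}) * partial i (p k))
      + prod p {1..m} * (\<Sum>j=1..l. T j * partial i (c j))) x = 0" for i
  proof -
    have comp_i: "(\<Sum>k=1..m. a k * peval (partial i (p k)) x / peval (p k) x)
        + (\<Sum>j=1..l. lam j * peval (partial i (c j)) x) = 0"
      using arg_cong[OF stat, of "\<lambda>g. g $ i"] unfolding grad_sum_ln_peval[OF p] grad_peval by simp
    have others: "(\<Prod>k'\<in>{1..m} - {k}. peval (p k') x) = P / peval (p k) x" if "k \<in> {1..m}" for k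
    proof -
      have "P = peval (p k) x * (\<Prod>k'\<in>{1..m} - {k}. peval (p k') x)"
        unfolding P_def using that by (intro prod.remove) auto
      moreover have "peval (p k) x \<noteq> 0"
        using p that by force
      ultimately show ?thesis
        by simp
    qed
    have "(\<Sum>k=1..m. a k * (\<Prod>k'\<in>{1..m} - {k}. peval (p k') x) * peval (partial i (p k)) x) =
        P * (\<Sum>k=1..m. a k * peval (partial i (p k)) x / peval (p k) x)"
      unfolding sum_distrib_left by (rule sum.cong[OF refl]) (simp only: others, simp)
    moreover have "(\<Sum>j=1..l. peval (T j) x * peval (partial i (c j)) x) =
        peval D x * (\<Sum>j=1..l. lam j * peval (partial i (c j)) x)"
      unfolding sum_distrib_left by (rule sum.cong) (simp_all add: T)
    ultimately have "peval (D * (\<Sum>k=1..m. pconst (a k) * prod p ({1..m} - {k}) * partial i (p k))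
        + prod p {1..m} * (\<Sum>j=1..l. T j * partial i (c j))) x =
      peval D x * P * ((\<Sum>k=1..m. a k * peval (partial i (p k)) x / peval (p k) x)
        + (\<Sum>j=1..l. lam j * peval (partial i (c j)) x))"
      by (simp add: P_def algebra_simps)
    then show ?thesis
      unfolding comp_i by simp
  qed
  have I: "j \<in> {1..l}" if "j \<in> I" for j
    using that EI by blast
  have T_c: "peval (T j) x * peval (c j) x = 0" if "j \<in> I" for j
    using compl that by (simp add: T[OF I[OF that]])
  have T_nonneg: "peval (T j) x \<ge> 0" if "j \<in> I" for j
    using compl that D by (simp add: T[OF I[OF that]])
  have "\<forall>\<phi>\<in>Phi m a p l E I c D T. peval \<phi> x = 0"
    unfolding Phi_def using x stationary T_c by (auto simp: semialg_def simp del: peval_add)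
  moreover have "\<forall>\<psi>\<in>Psi I c T. peval \<psi> x \<ge> 0"
    unfolding Psi_def using x T_nonneg by (auto simp: semialg_def)
  ultimately show ?thesis
    by (simp add: semialg_def)
qed

lemma semialg_antimono: "Eqs \<subseteq> Eqs' \<Longrightarrow> Ineqs \<subseteq> Ineqs' \<Longrightarrow> semialg Eqs' Ineqs' \<subseteq> semialg Eqs Ineqs"
  unfolding semialg_def by blast

lemma mom_feas_k_antimono:
  "Eqs \<subseteq> Eqs' \<Longrightarrow> Ineqs \<subseteq> Ineqs' \<Longrightarrow> mom_feas_k k Eqs' Ineqs' \<subseteq> mom_feas_k k Eqs Ineqs"
  unfolding mom_feas_k_def by blast

theorem proposition5p2:
  fixes m l :: nat
    and a :: "nat \<Rightarrow> real"
    and E I :: "nat set"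
    and p c :: "nat \<Rightarrow> 'n::{finite,linorder} rpoly"
    and K K1 :: "(real ^ 'n::{finite,linorder}) set"
    and \<tau> :: "nat \<Rightarrow> 'n rpoly fract"
    and D :: "'n rpoly"
    and T :: "nat \<Rightarrow> 'n rpoly"
    and \<Phi> \<Psi> :: "'n rpoly set"
    and d d1 :: nat
    and fmax fmom flme :: ereal
    and fmomk flmek :: "nat \<Rightarrow> ereal"
  defines "K \<equiv> semialg (c ` E) (c ` I)"
    and "\<Phi> \<equiv> Phi m a p l E I c D T"
    and "\<Psi> \<equiv> Psi I c T"
    and "K1 \<equiv> semialg \<Phi> \<Psi>"
    and "d \<equiv> Max (hdeg ` (p ` {1..m} \<union> c ` {1..l}))"
    and "d1 \<equiv> Max (hdeg ` (\<Phi> \<union> \<Psi>))"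
    and "fmax \<equiv> opt_val (f_obj m a p) K"
    and "fmom \<equiv> opt_val (mom_obj m a p) (mom_feas d K)"
    and "flme \<equiv> opt_val (mom_obj m a p) (mom_feas d K1)"
    and "fmomk \<equiv> (\<lambda>k. opt_val (mom_obj m a p) (mom_feas_k k (c ` E) (c ` I)))"
    and "flmek \<equiv> (\<lambda>k. opt_val (mom_obj m a p) (mom_feas_k k \<Phi> \<Psi>))"
  assumes "m \<ge> 1"
    and "\<forall>i\<in>{1..m}. a i > 0"
    and "E \<inter> I = {}" and "E \<union> I = {1..l}"
    and "\<forall>i\<in>{1..m}. \<forall>x\<in>K. peval (p i) x > 0"
    and "\<exists>x. is_arg_max (f_obj m a p) (\<lambda>x. x \<in> K) x"
    and "\<forall>x. is_arg_max (f_obj m a p) (\<lambda>x. x \<in> K) x \<longrightarrow>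
               (\<exists>lam. (x, lam) \<in> crit_pairs m a p l E I c)"
    and "\<forall>j\<in>{1..l}. \<exists>N Q. \<tau> j = Fraction_Field.Fract N Q \<and> (\<forall>x\<in>K. peval Q x > 0)"
    and "\<forall>(x, lam)\<in>crit_pairs m a p l E I c. \<forall>j\<in>{1..l}. lam j = rat_eval (\<tau> j) x"
    and "\<forall>x\<in>K. peval D x > 0"
    and "\<forall>j\<in>{1..l}. to_fract D * \<tau> j = to_fract (T j)"
    and "(\<forall>j\<in>{1..l}. \<exists>q. \<tau> j = to_fract q) \<longrightarrow> D = 1"
  shows "convex_problem (mom_obj m a p) (mom_feas d K1) \<and>
         is_relaxation (mom_obj m a p) (mom_feas d K1) (f_obj m a p) K \<and>
         (\<forall>k\<ge>max d d1. convex_problem (mom_obj m a p) (mom_feas_k k \<Phi> \<Psi>) \<and>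
                        is_relaxation (mom_obj m a p) (mom_feas_k k \<Phi> \<Psi>) (f_obj m a p) K) \<and>
         (\<forall>k\<ge>max d d1. fmomk k \<ge> fmom \<and> fmom \<ge> fmax \<and> flmek k \<ge> flme \<and> flme \<ge> fmax \<and>
                        fmomk k \<ge> flmek k \<and> fmom \<ge> flme)"
proof -
  have a: "\<forall>i\<in>{1..m}. a i > 0" and EI: "E \<union> I = {1..l}"
    and p_pos: "\<forall>i\<in>{1..m}. \<forall>x\<in>K. peval (p i) x > 0"
    by fact+
  obtain u where u: "is_arg_max (f_obj m a p) (\<lambda>x. x \<in> K) u"
    using \<open>\<exists>x. is_arg_max (f_obj m a p) (\<lambda>x. x \<in> K) x\<close> by blast
  then have u_K: "u \<in> K" and u_max: "\<And>x. x \<in> K \<Longrightarrow> f_obj m a p x \<le> f_obj m a p u"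
    by (auto simp: is_arg_max_def not_less)
  obtain lam where lam: "(u, lam) \<in> crit_pairs m a p l E I c"
    using u assms by blast
  have T_u: "peval (T j) u = peval D u * lam j" if j: "j \<in> {1..l}" for j
  proof -
    obtain N Q where "\<tau> j = Fraction_Field.Fract N Q" "\<forall>x\<in>K. peval Q x > 0"
      using j \<open>\<forall>j\<in>{1..l}. \<exists>N Q. \<tau> j = Fraction_Field.Fract N Q \<and> (\<forall>x\<in>K. peval Q x > 0)\<close> by blast
    moreover have "to_fract D * \<tau> j = to_fract (T j)"
      using j assms by blast
    ultimately have "peval (T j) u = peval D u * rat_eval (\<tau> j) u"
      using u_K by (intro rat_eval_cleared) force+
    moreover have "lam j = rat_eval (\<tau> j) u"
      using \<open>\<forall>(x, lam)\<in>crit_pairs m a p l E I c. \<forall>j\<in>{1..l}. lam j = rat_eval (\<tau> j) x\<close> lam j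
      by blast
    ultimately show ?thesis
      by simp
  qed
  have u_K1: "u \<in> K1"
    unfolding K1_def \<Phi>_def \<Psi>_def
    by (rule critical_point_in_semialg_Phi_Psi[OF lam EI])
       (use u_K p_pos T_u \<open>\<forall>x\<in>K. peval D x > 0\<close> in \<open>auto simp: less_imp_le\<close>)

  have sub: "c ` E \<subseteq> \<Phi>" "c ` I \<subseteq> \<Psi>"
    by (auto simp: \<Phi>_def \<Psi>_def Phi_def Psi_def)
  have fin: "finite E" "finite I"
    using EI by (metis finite_Un finite_atLeastAtMost)+
  then have fin_\<Phi>\<Psi>: "finite (\<Phi> \<union> \<Psi>)"
    by (simp add: \<Phi>_def \<Psi>_def Phi_def Psi_def)
  have hdeg_p: "hdeg (p i) \<le> d" if "i \<in> {1..m}" for i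
    unfolding d_def using that by (intro Max_ge) auto
  have hdeg_c: "hdeg q \<le> d" if "q \<in> c ` E \<union> c ` I" for q
    unfolding d_def using that EI by (intro Max_ge) auto
  have hdeg_\<Phi>\<Psi>: "hdeg q \<le> d1" if "q \<in> \<Phi> \<union> \<Psi>" for q
    unfolding d1_def using that fin_\<Phi>\<Psi> by (intro Max_ge) auto

  have "fmax \<le> f_obj m a p u"
    unfolding fmax_def opt_val_def by (rule SUP_least) (rule u_max)
  also have "\<dots> \<le> flme"
    unfolding flme_def using hdeg_p u_K1 by (rule f_obj_le_moment_problem)
  finally have max_lme: "fmax \<le> flme" .
  have "K1 \<subseteq> K"
    unfolding K1_def K_def by (rule semialg_antimono[OF sub])
  then have lme_mom: "flme \<le> fmom"
    unfolding flme_def fmom_def opt_val_def by (intro SUP_subset_mono mom_feas_mono) auto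
  have lme_k: "flme \<le> flmek k" and mom_k: "fmom \<le> fmomk k" if k: "k \<ge> max d d1" for k
  proof -
    show "flme \<le> flmek k"
      unfolding flme_def flmek_def K1_def
    proof (rule moment_problem_le_semidefinite_relaxation[OF hdeg_p])
      show "hdeg q \<le> k" if "q \<in> \<Phi> \<union> \<Psi>" for q
        using hdeg_\<Phi>\<Psi>[OF that] k by simp
    qed (use k in auto)
    show "fmom \<le> fmomk k"
      unfolding fmom_def fmomk_def K_def
    proof (rule moment_problem_le_semidefinite_relaxation[OF hdeg_p])
      show "hdeg q \<le> k" if "q \<in> c ` E \<union> c ` I" for q
        using hdeg_c[OF that] k by simp
    qed (use k in auto)
  qed
  have lmek_momk: "flmek k \<le> fmomk k" for k
    unfolding flmek_def fmomk_def opt_val_def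
    using mom_feas_k_antimono[OF sub] by (intro SUP_subset_mono) auto

  have conv: "convex_problem (mom_obj m a p) (mom_feas d K1)"
    "convex_problem (mom_obj m a p) (mom_feas_k k \<Phi> \<Psi>)" for k
    using a by (rule convex_problem_mom_feas, rule convex_problem_mom_feas_k)
  have relax: "is_relaxation (mom_obj m a p) (mom_feas d K1) (f_obj m a p) K"
    using max_lme by (simp add: is_relaxation_def fmax_def flme_def)
  have relax_k: "is_relaxation (mom_obj m a p) (mom_feas_k k \<Phi> \<Psi>) (f_obj m a p) K"
    if "k \<ge> max d d1" for k
    using order_trans[OF max_lme lme_k[OF that]] by (simp add: is_relaxation_def fmax_def flmek_def)
  show ?thesis
    using conv relax relax_k lme_k mom_k lmek_momk max_lme lme_mom order_trans[OF max_lme lme_mom]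
    by blast
qed

end
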